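(* Let $X$ be an irreducible subshift over a finite alphabet that has almost specification with the constant mistake function $g\equiv 1$. Then either $X$ has left almost specification with $g\equiv 1$ or $X$ has right almost specification with $g\equiv 1$.
   Context: A subshift is a closed shift-invariant subset $X\subset A^{\mathbb Z}$, $A$ a finite alphabet. Its language $\mathcal L(X)$ is the set of all finite words appearing in points of $X$; $|w|$ is the length of the word $w$. $X$ is irreducible if for all $u,v\in\mathcal L(X)$ there is a word $w$ with $uwv\in\mathcal L(X)$. For words of equal length, $d_H(v,w)=|\{i: v(i)\neq w(i)\}|$ (Hamming distance). In the following definitions the mistake function satisfies $g(n)/n\to0$, and distance conditions are vacuous for the empty word. Almost specification with mistake function $g$: for any $w^{(1)},\dots,w^{(k)}\in\mathcal L(X)$ there are $\bar w^{(1)},\dots,\bar w^{(k)}\in\mathcal L(X)$ with $|\bar w^{(i)}|=|w^{(i)}|$ and $d_H(\bar w^{(i)},w^{(i)})\le g(|w^{(i)}|)$ for $1\le i\le k$, and $\bar w^{(1)}\cdots\bar w^{(k)}\in\mathcal L(X)$. Left almost specification with mistake function $g$: for any $w^{(1)},w^{(2)}\in\mathcal L(X)$ there is $\bar w^{(1)}\in\mathcal L(X)$ of length $|w^{(1)}|$ with $d_H(\bar w^{(1)},w^{(1)})\le g(|w^{(1)}|)$ and $\bar w^{(1)}w^{(2)}\in\mathcal L(X)$. Right almost specification with mistake function $g$: for any $w^{(1)},w^{(2)}\in\mathcal L(X)$ there is $\bar w^{(2)}\in\mathcal L(X)$ of length $|w^{(2)}|$ with $d_H(\bar w^{(2)},w^{(2)})\le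 g(|w^{(2)}|)$ and $w^{(1)}\bar w^{(2)}\in\mathcal L(X)$. *)

theory Defs
  imports "HOL-Analysis.Analysis"
begin

definition shift :: "(int \<Rightarrow> 'a) \<Rightarrow> int \<Rightarrow> 'a" where
  "shift x = (\<lambda>i. x (i + 1))"

(* The full shift over A carries the product of the discrete topologies on A;
   closedin includes that X is contained in the full shift. *)
definition subshift :: "'a set \<Rightarrow> (int \<Rightarrow> 'a) set \<Rightarrow> bool" where
  "subshift A X \<longleftrightarrow>
     finite A \<and>
     closedin (product_topology (\<lambda>_::int. discrete_topology A) UNIV) X \<and>
     shift ` X = X"

definition language :: "(int \<Rightarrow> 'a) set \<Rightarrow> 'a list set" where
  "language X = {w. \<exists>x\<in>X. \<exists>i::int. \<exists>n. w = map (\<lambda>j. x (i + int j)) [0..<n]}"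

definition irreducible_subshift :: "(int \<Rightarrow> 'a) set \<Rightarrow> bool" where
  "irreducible_subshift X \<longleftrightarrow>
     (\<forall>u\<in>language X. \<forall>v\<in>language X. \<exists>w. u @ w @ v \<in> language X)"

(* Used only for words of equal length. *)
definition hamming :: "'a list \<Rightarrow> 'a list \<Rightarrow> nat" where
  "hamming v w = card {i. i < length v \<and> v ! i \<noteq> w ! i}"

(* At n = 0 there is no constraint on g: division by zero gives 0, and the
   limit ignores single terms anyway. *)
definition mistake_function :: "(nat \<Rightarrow> nat) \<Rightarrow> bool" where
  "mistake_function g \<longleftrightarrow> (\<lambda>n. real (g n) / real n) \<longlonglongrightarrow> 0"

(* For the empty word the distance conditions below are vacuous, since the
   distance is 0 and g has natural values. *)
definition almost_specification :: "(nat \<Rightarrow> nat) \<Rightarrow> (int \<Rightarrow> 'a) set \<Rightarrow> bool" where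
  "almost_specification g X \<longleftrightarrow>
     mistake_function g \<and>
     (\<forall>ws. ws \<noteq> [] \<and> set ws \<subseteq> language X \<longrightarrow>
        (\<exists>vs. length vs = length ws \<and> set vs \<subseteq> language X \<and>
           (\<forall>i<length ws. length (vs ! i) = length (ws ! i) \<and>
              hamming (vs ! i) (ws ! i) \<le> g (length (ws ! i))) \<and>
           concat vs \<in> language X))"

definition left_almost_specification :: "(nat \<Rightarrow> nat) \<Rightarrow> (int \<Rightarrow> 'a) set \<Rightarrow> bool" where
  "left_almost_specification g X \<longleftrightarrow>
     mistake_function g \<and>
     (\<forall>w1\<in>language X. \<forall>w2\<in>language X.
        \<exists>v1\<in>language X. length v1 = length w1 \<and>
          hamming v1 w1 \<le> g (length w1) \<and> v1 @ w2 \<in> language X)"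

definition right_almost_specification :: "(nat \<Rightarrow> nat) \<Rightarrow> (int \<Rightarrow> 'a) set \<Rightarrow> bool" where
  "right_almost_specification g X \<longleftrightarrow>
     mistake_function g \<and>
     (\<forall>w1\<in>language X. \<forall>w2\<in>language X.
        \<exists>v2\<in>language X. length v2 = length w2 \<and>
          hamming v2 w2 \<le> g (length w2) \<and> w1 @ v2 \<in> language X)"

end

theory Submission
  imports Defs
begin

text \<open>Suppose that both one-sided properties fail. A failure of the left property is a pair of
  words \<open>u1\<close>, \<open>u2\<close> such that \<open>u2\<close> cannot be preceded by any word within one mistake of \<open>u1\<close>; a
  failure of the right property is a pair \<open>w1\<close>, \<open>w2\<close> such that \<open>w1\<close> cannot be followed by any word
  within one mistake of \<open>w2\<close>. Irreducibility provides words \<open>b = w2 y u1\<close> and \<open>c = u2 z w1\<close> of the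
  language. Almost specification turns \<open>b c b\<close> into a word of the language with at most one mistake
  in each block. At the first junction, the end of \<open>b\<close> still lies within one mistake of \<open>u1\<close>, so
  the prefix \<open>u2\<close> of \<open>c\<close> must have been changed. At the second junction, the start of \<open>b\<close> lies
  within one mistake of \<open>w2\<close>, so the suffix \<open>w1\<close> of \<open>c\<close> must have been changed as well. Hence \<open>c\<close>
  received two mistakes, a contradiction.\<close>

lemma language_factor:
  assumes "p @ w @ s \<in> language X"
  shows "w \<in> language X"
proof -
  obtain x i n where x: "x \<in> X" and eq: "p @ w @ s = map (\<lambda>j. x (i + int j)) [0..<n]"
    using assms by (auto simp: language_def)
  have len: "length p + length w + length s = n"
    using arg_cong[OF eq, of length] by simp
  have "w = map (\<lambda>j. x ((i + int (length p)) + int j)) [0..<length w]"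
  proof (rule nth_equalityI)
    fix k assume "k < length w"
    then have "w ! k = (p @ w @ s) ! (length p + k)"
      by (simp add: nth_append)
    also have "\<dots> = x (i + int (length p + k))"
      unfolding eq using \<open>k < length w\<close> len by simp
    finally show "w ! k = map (\<lambda>j. x ((i + int (length p)) + int j)) [0..<length w] ! k"
      using \<open>k < length w\<close> by (simp add: add.assoc)
  qed simp
  then show ?thesis
    using x unfolding language_def by blast
qed

lemma hamming_append:
  assumes "length a = length c"
  shows "hamming (a @ b) (c @ d) = hamming a c + hamming b d"
proof -
  let ?S = "{i. i < length a \<and> a ! i \<noteq> c ! i}"
  let ?T = "{i. i < length b \<and> b ! i \<noteq> d ! i}"
  have "{i. i < length (a @ b) \<and> (a @ b) ! i \<noteq> (c @ d) ! i} = ?S \<union> (\<lambda>i. length a + i) ` ?T"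
    (is "?U = ?V")
  proof (rule set_eqI)
    fix i
    show "i \<in> ?U \<longleftrightarrow> i \<in> ?V"
    proof (cases "i < length a")
      case True
      then show ?thesis using assms by (auto simp: nth_append)
    next
      case False
      then obtain j where "i = length a + j"
        by (metis le_iff_add not_less)
      then show ?thesis using assms by (auto simp: nth_append)
    qed
  qed
  moreover have "card (?S \<union> (\<lambda>i. length a + i) ` ?T) = card ?S + card ((\<lambda>i. length a + i) ` ?T)"
    by (rule card_Un_disjoint) auto
  moreover have "card ((\<lambda>i. length a + i) ` ?T) = card ?T"
    by (rule card_image) simp
  ultimately show ?thesis
    by (simp add: hamming_def)
qed

lemma hamming_eq_0_iff:
  assumes "length v = length w"
  shows "hamming v w = 0 \<longleftrightarrow> v = w"
  using assms by (auto simp: hamming_def list_eq_iff_nth_eq)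

lemma split_like_append3:
  assumes "length v = length (a @ b @ c)"
  obtains a' b' c' where "v = a' @ b' @ c'"
    "length a' = length a" "length b' = length b" "length c' = length c"
proof
  show "v = take (length a) v @ take (length b) (drop (length a) v)
      @ drop (length b) (drop (length a) v)"
    by (simp only: append_take_drop_id)
qed (use assms in auto)

lemma almost_specification_three_words:
  assumes "almost_specification g X"
    and "w1 \<in> language X" "w2 \<in> language X" "w3 \<in> language X"
  obtains v1 v2 v3 where "v1 @ v2 @ v3 \<in> language X"
    "length v1 = length w1" "hamming v1 w1 \<le> g (length w1)"
    "length v2 = length w2" "hamming v2 w2 \<le> g (length w2)"
    "length v3 = length w3" "hamming v3 w3 \<le> g (length w3)"
proof -
  have "[w1, w2, w3] \<noteq> [] \<and> set [w1, w2, w3] \<subseteq> language X"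
    using assms by simp
  then obtain vs where vs: "length vs = length [w1, w2, w3]" "concat vs \<in> language X"
    "\<And>i. i < length [w1, w2, w3] \<Longrightarrow> length (vs ! i) = length ([w1, w2, w3] ! i) \<and>
       hamming (vs ! i) ([w1, w2, w3] ! i) \<le> g (length ([w1, w2, w3] ! i))"
    using assms(1) unfolding almost_specification_def by metis
  obtain v1 v2 v3 where "vs = [v1, v2, v3]"
    using vs(1) by (auto simp: length_Suc_conv)
  then show thesis
    using that[of v1 v2 v3] vs(2) vs(3)[of 0] vs(3)[of 1] vs(3)[of 2] by simp
qed

theorem lemma4p1:
  fixes A :: "'a set" and X :: "(int \<Rightarrow> 'a) set"
  assumes "subshift A X"
    and "irreducible_subshift X"
    and "almost_specification (\<lambda>_. 1) X"
  shows "left_almost_specification (\<lambda>_. 1) X \<or> right_almost_specification (\<lambda>_. 1) X"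
proof (rule ccontr)
  assume neither: "\<not> ?thesis"
  have g: "mistake_function (\<lambda>_. 1)"
    using assms(3) by (simp add: almost_specification_def)
  obtain u1 u2 where u: "u1 \<in> language X" "u2 \<in> language X"
    and not_left: "\<And>v. v \<in> language X \<Longrightarrow> length v = length u1 \<Longrightarrow> hamming v u1 \<le> 1
      \<Longrightarrow> v @ u2 \<notin> language X"
    using neither g unfolding left_almost_specification_def by blast
  obtain w1 w2 where w: "w1 \<in> language X" "w2 \<in> language X"
    and not_right: "\<And>v. v \<in> language X \<Longrightarrow> length v = length w2 \<Longrightarrow> hamming v w2 \<le> 1
      \<Longrightarrow> w1 @ v \<notin> language X"
    using neither g unfolding right_almost_specification_def by blast
  obtain y where b: "w2 @ y @ u1 \<in> language X"
    using assms(2) u w unfolding irreducible_subshift_def by blast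
  obtain z where c: "u2 @ z @ w1 \<in> language X"
    using assms(2) u w unfolding irreducible_subshift_def by blast
  obtain b1 c1 b2 where bcb: "b1 @ c1 @ b2 \<in> language X"
    and b1: "length b1 = length (w2 @ y @ u1)" "hamming b1 (w2 @ y @ u1) \<le> 1"
    and c1: "length c1 = length (u2 @ z @ w1)" "hamming c1 (u2 @ z @ w1) \<le> 1"
    and b2: "length b2 = length (w2 @ y @ u1)" "hamming b2 (w2 @ y @ u1) \<le> 1"
    using almost_specification_three_words[OF assms(3) b c b] by blast
  obtain p q v where b1_eq: "b1 = p @ q @ v"
    and b1_len: "length p = length w2" "length q = length y" "length v = length u1"
    using split_like_append3[OF b1(1)] .
  obtain u2' z' w1' where c1_eq: "c1 = u2' @ z' @ w1'"
    and c1_len: "length u2' = length u2" "length z' = length z" "length w1' = length w1"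
    using split_like_append3[OF c1(1)] .
  obtain v' r s where b2_eq: "b2 = v' @ r @ s"
    and b2_len: "length v' = length w2" "length r = length y" "length s = length u1"
    using split_like_append3[OF b2(1)] .
  \<comment> \<open>Otherwise \<open>v\<close> would be a word within one mistake of \<open>u1\<close> that can precede \<open>u2\<close>.\<close>
  have "u2' \<noteq> u2"
  proof -
    have "v @ u2' \<in> language X"
      using bcb language_factor[of "p @ q" "v @ u2'" "z' @ w1' @ b2" X]
      by (simp add: b1_eq c1_eq)
    moreover have "v \<in> language X"
      using \<open>v @ u2' \<in> language X\<close> language_factor[of "[]" v u2' X] by simp
    moreover have "hamming v u1 \<le> 1"
      using b1(2) by (simp add: b1_eq hamming_append b1_len)
    ultimately show ?thesis
      using not_left[of v] b1_len by blast
  qed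
  then have "1 \<le> hamming u2' u2"
    using hamming_eq_0_iff[OF c1_len(1)] by simp
  \<comment> \<open>Otherwise \<open>v'\<close> would be a word within one mistake of \<open>w2\<close> that can follow \<open>w1\<close>.\<close>
  moreover have "w1' \<noteq> w1"
  proof -
    have "w1' @ v' \<in> language X"
      using bcb language_factor[of "b1 @ u2' @ z'" "w1' @ v'" "r @ s" X]
      by (simp add: c1_eq b2_eq)
    moreover have "v' \<in> language X"
      using \<open>w1' @ v' \<in> language X\<close> language_factor[of w1' v' "[]" X] by simp
    moreover have "hamming v' w2 \<le> 1"
      using b2(2) by (simp add: b2_eq hamming_append b2_len)
    ultimately show ?thesis
      using not_right[of v'] b2_len by blast
  qed
  then have "1 \<le> hamming w1' w1"
    using hamming_eq_0_iff[OF c1_len(3)] by simp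
  moreover have "hamming u2' u2 + hamming z' z + hamming w1' w1 \<le> 1"
    using c1(2) by (simp add: c1_eq hamming_append c1_len)
  ultimately show False
    by linarith
qed

end
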